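(* Let $\mathcal{A}$ be an essentially small additive category and $K$ a field. Suppose that $\mathcal{A}$ is $L$-linear, where $L$ is an infinite (commutative) field with $\mathrm{char}(L)\neq\mathrm{char}(K)$. Then every functor in $\mathcal{F}^{\mathrm{df}}(\mathcal{A};K)$ is constant, i.e. the category $\mathcal{F}^{\mathrm{df}}(\mathcal{A};K)$ is reduced to the constant functors.
   Context: $\mathcal{F}^{\mathrm{df}}(\mathcal{A};K)$ is the category of all (not necessarily additive) functors from $\mathcal{A}$ to the category of $K$-vector spaces all of whose values are finite-dimensional over $K$. "Constant" means isomorphic to a constant functor. *)

theory Defs
  imports
    "Jordan_Normal_Form.Missing_VectorSpace"
    "HOL-Algebra.Multiplicative_Group"
begin

text \<open>The objects of a category form a set in some HOL type, so every category below is small.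
  As the type is arbitrary, this covers the essentially small categories, each
  of which is equivalent to a small one; no separate hypothesis is needed.\<close>

record ('o, 'm) cat =
  Obj :: "'o set"
  Hom :: "'o \<Rightarrow> 'o \<Rightarrow> 'm set"
  Comp :: "'m \<Rightarrow> 'm \<Rightarrow> 'm"
  Ident :: "'o \<Rightarrow> 'm"

locale category =
  fixes A :: "('o, 'm, 'x) cat_scheme"
  assumes Hom_disjoint:
      "\<lbrakk>X \<in> Obj A; Y \<in> Obj A; X' \<in> Obj A; Y' \<in> Obj A; f \<in> Hom A X Y; f \<in> Hom A X' Y'\<rbrakk>
        \<Longrightarrow> X = X' \<and> Y = Y'"
    and Ident_closed: "X \<in> Obj A \<Longrightarrow> Ident A X \<in> Hom A X X"
    and Comp_closed:
      "\<lbrakk>X \<in> Obj A; Y \<in> Obj A; Z \<in> Obj A; g \<in> Hom A Y Z; f \<in> Hom A X Y\<rbrakk>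
        \<Longrightarrow> Comp A g f \<in> Hom A X Z"
    and Comp_Ident_right:
      "\<lbrakk>X \<in> Obj A; Y \<in> Obj A; f \<in> Hom A X Y\<rbrakk> \<Longrightarrow> Comp A f (Ident A X) = f"
    and Comp_Ident_left:
      "\<lbrakk>X \<in> Obj A; Y \<in> Obj A; f \<in> Hom A X Y\<rbrakk> \<Longrightarrow> Comp A (Ident A Y) f = f"
    and Comp_assoc:
      "\<lbrakk>W \<in> Obj A; X \<in> Obj A; Y \<in> Obj A; Z \<in> Obj A;
        h \<in> Hom A Y Z; g \<in> Hom A X Y; f \<in> Hom A W X\<rbrakk>
        \<Longrightarrow> Comp A (Comp A h g) f = Comp A h (Comp A g f)"

text \<open>Because the sets of morphisms are pairwise disjoint, a single binary operation
  \<open>Add\<close> can hold the addition of all of them; only the zero morphisms depend on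
  the two objects.\<close>

record ('o, 'm) preadd_cat = "('o, 'm) cat" +
  Add :: "'m \<Rightarrow> 'm \<Rightarrow> 'm"
  Zero :: "'o \<Rightarrow> 'o \<Rightarrow> 'm"

definition hom_group :: "('o, 'm, 'x) preadd_cat_scheme \<Rightarrow> 'o \<Rightarrow> 'o \<Rightarrow> 'm monoid" where
  "hom_group A X Y =
    \<lparr>carrier = Hom A X Y, monoid.mult = Add A, one = Zero A X Y\<rparr>"

locale preadditive_category = category A
  for A :: "('o, 'm, 'x) preadd_cat_scheme" +
  assumes hom_comm_group:
      "\<lbrakk>X \<in> Obj A; Y \<in> Obj A\<rbrakk> \<Longrightarrow> comm_group (hom_group A X Y)"
    and Comp_Add_left:
      "\<lbrakk>X \<in> Obj A; Y \<in> Obj A; Z \<in> Obj A; g \<in> Hom A Y Z; g' \<in> Hom A Y Z; f \<in> Hom A X Y\<rbrakk>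
        \<Longrightarrow> Comp A (Add A g g') f = Add A (Comp A g f) (Comp A g' f)"
    and Comp_Add_right:
      "\<lbrakk>X \<in> Obj A; Y \<in> Obj A; Z \<in> Obj A; g \<in> Hom A Y Z; f \<in> Hom A X Y; f' \<in> Hom A X Y\<rbrakk>
        \<Longrightarrow> Comp A g (Add A f f') = Add A (Comp A g f) (Comp A g f')"

definition zero_object :: "('o, 'm, 'x) cat_scheme \<Rightarrow> 'o \<Rightarrow> bool" where
  "zero_object A Z \<longleftrightarrow>
    Z \<in> Obj A \<and> (\<forall>X \<in> Obj A. (\<exists>!f. f \<in> Hom A X Z) \<and> (\<exists>!f. f \<in> Hom A Z X))"

definition biproduct ::
  "('o, 'm, 'x) preadd_cat_scheme \<Rightarrow> 'o \<Rightarrow> 'o \<Rightarrow> 'o \<Rightarrow> 'm \<Rightarrow> 'm \<Rightarrow> 'm \<Rightarrow> 'm \<Rightarrow> bool" where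
  "biproduct A X Y P i j p q \<longleftrightarrow>
    P \<in> Obj A \<and> i \<in> Hom A X P \<and> j \<in> Hom A Y P \<and> p \<in> Hom A P X \<and> q \<in> Hom A P Y \<and>
    Comp A p i = Ident A X \<and> Comp A q j = Ident A Y \<and>
    Comp A p j = Zero A Y X \<and> Comp A q i = Zero A X Y \<and>
    Add A (Comp A i p) (Comp A j q) = Ident A P"

locale additive_category = preadditive_category A
  for A :: "('o, 'm, 'x) preadd_cat_scheme" +
  assumes zero_object_exists: "\<exists>Z. zero_object A Z"
    and biproduct_exists:
      "\<lbrakk>X \<in> Obj A; Y \<in> Obj A\<rbrakk> \<Longrightarrow> \<exists>P i j p q. biproduct A X Y P i j p q"

text \<open>The components \<open>mult\<close> and \<open>one\<close> of a module record are not used by the vector space axioms.\<close>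

definition hom_space ::
  "('o, 'm, 'x) preadd_cat_scheme \<Rightarrow> ('l \<Rightarrow> 'm \<Rightarrow> 'm) \<Rightarrow> 'o \<Rightarrow> 'o \<Rightarrow> ('l, 'm) module" where
  "hom_space A s X Y =
    \<lparr>carrier = Hom A X Y, monoid.mult = undefined, one = undefined,
     zero = Zero A X Y, add = Add A, smult = s\<rparr>"

locale linear_category = preadditive_category A + field L
  for A :: "('o, 'm, 'x) preadd_cat_scheme"
    and L :: "('l, 'y) ring_scheme"
    and s :: "'l \<Rightarrow> 'm \<Rightarrow> 'm" +
  assumes hom_vectorspace:
      "\<lbrakk>X \<in> Obj A; Y \<in> Obj A\<rbrakk> \<Longrightarrow> vectorspace L (hom_space A s X Y)"
    and Comp_scale_left:
      "\<lbrakk>a \<in> carrier L; X \<in> Obj A; Y \<in> Obj A; Z \<in> Obj A; g \<in> Hom A Y Z; f \<in> Hom A X Y\<rbrakk>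
        \<Longrightarrow> Comp A (s a g) f = s a (Comp A g f)"
    and Comp_scale_right:
      "\<lbrakk>a \<in> carrier L; X \<in> Obj A; Y \<in> Obj A; Z \<in> Obj A; g \<in> Hom A Y Z; f \<in> Hom A X Y\<rbrakk>
        \<Longrightarrow> Comp A g (s a f) = s a (Comp A g f)"

text \<open>The characteristic is the additive order of the unit; \<^const>\<open>group.ord\<close> is \<open>0\<close> for
  elements of infinite order.\<close>

definition ring_char :: "('k, 'y) ring_scheme \<Rightarrow> nat" where
  "ring_char R = group.ord (add_monoid R) \<one>\<^bsub>R\<^esub>"

text \<open>Functors to vector spaces. Linear maps are HOL functions of which only the restriction to
  the carrier of the source matters, so equations between them are stated on carriers.\<close>

record ('o, 'm, 'k, 'v) vfunctor =
  fobj :: "'o \<Rightarrow> ('k, 'v) module"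
  fmap :: "'m \<Rightarrow> 'v \<Rightarrow> 'v"

locale vect_functor = category A + field K
  for A :: "('o, 'm, 'x) cat_scheme"
    and K :: "('k, 'y) ring_scheme"
    and F :: "('o, 'm, 'k, 'v) vfunctor" +
  assumes fobj_vectorspace: "X \<in> Obj A \<Longrightarrow> vectorspace K (fobj F X)"
    and fmap_linear:
      "\<lbrakk>X \<in> Obj A; Y \<in> Obj A; f \<in> Hom A X Y\<rbrakk>
        \<Longrightarrow> linear_map K (fobj F X) (fobj F Y) (fmap F f)"
    and fmap_Ident:
      "\<lbrakk>X \<in> Obj A; v \<in> carrier (fobj F X)\<rbrakk> \<Longrightarrow> fmap F (Ident A X) v = v"
    and fmap_Comp:
      "\<lbrakk>X \<in> Obj A; Y \<in> Obj A; Z \<in> Obj A; g \<in> Hom A Y Z; f \<in> Hom A X Y;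
        v \<in> carrier (fobj F X)\<rbrakk>
        \<Longrightarrow> fmap F (Comp A g f) v = fmap F g (fmap F f v)"

text \<open>The class of objects of \<open>\<F>\<^sup>d\<^sup>f(A; K)\<close>.\<close>

definition Fdf ::
  "('o, 'm, 'x) cat_scheme \<Rightarrow> ('k, 'y) ring_scheme \<Rightarrow> ('o, 'm, 'k, 'v) vfunctor set" where
  "Fdf A K =
    {F. vect_functor A K F \<and> (\<forall>X \<in> Obj A. vectorspace.fin_dim K (fobj F X))}"

definition nat_transf ::
  "('o, 'm, 'x) cat_scheme \<Rightarrow> ('k, 'y) ring_scheme \<Rightarrow>
    ('o, 'm, 'k, 'v) vfunctor \<Rightarrow> ('o, 'm, 'k, 'w) vfunctor \<Rightarrow> ('o \<Rightarrow> 'v \<Rightarrow> 'w) \<Rightarrow> bool" where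
  "nat_transf A K F G \<eta> \<longleftrightarrow>
    (\<forall>X \<in> Obj A. linear_map K (fobj F X) (fobj G X) (\<eta> X)) \<and>
    (\<forall>X \<in> Obj A. \<forall>Y \<in> Obj A. \<forall>f \<in> Hom A X Y. \<forall>v \<in> carrier (fobj F X).
      \<eta> Y (fmap F f v) = fmap G f (\<eta> X v))"

definition functor_iso ::
  "('o, 'm, 'x) cat_scheme \<Rightarrow> ('k, 'y) ring_scheme \<Rightarrow>
    ('o, 'm, 'k, 'v) vfunctor \<Rightarrow> ('o, 'm, 'k, 'w) vfunctor \<Rightarrow> bool" where
  "functor_iso A K F G \<longleftrightarrow>
    (\<exists>\<eta> \<theta>. nat_transf A K F G \<eta> \<and> nat_transf A K G F \<theta> \<and>
      (\<forall>X \<in> Obj A. (\<forall>v \<in> carrier (fobj F X). \<theta> X (\<eta> X v) = v) \<and>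
                   (\<forall>w \<in> carrier (fobj G X). \<eta> X (\<theta> X w) = w)))"

definition const_functor :: "('k, 'v) module \<Rightarrow> ('o, 'm, 'k, 'v) vfunctor" where
  "const_functor V = \<lparr>fobj = (\<lambda>_. V), fmap = (\<lambda>_ v. v)\<rparr>"

definition is_constant ::
  "('o, 'm, 'x) cat_scheme \<Rightarrow> ('k, 'y) ring_scheme \<Rightarrow> ('o, 'm, 'k, 'v) vfunctor \<Rightarrow> bool" where
  "is_constant A K F \<longleftrightarrow>
    (\<exists>V :: ('k, 'v) module. vectorspace K V \<and> functor_iso A K F (const_functor V))"

end

theory Submission
  imports Defs
begin

text \<open>
  Since \<open>A\<close> has a zero object, a functor \<open>F\<close> is constant as soon as each zero endomorphism
  \<open>0 : X \<rightarrow> 0 \<rightarrow> X\<close> acts on \<open>F X\<close> as the identity: the maps \<open>X \<rightarrow> 0 \<rightarrow> X\<close> then induce an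
  isomorphism of \<open>F\<close> with the constant functor at \<open>F 0\<close>
  (\<open>constant_if_zero_endomorphisms_act_trivially\<close>). So it is enough to show that
  \<open>f a = F (a \<cdot> id\<^sub>X) v\<close>, a function of \<open>a \<in> L\<close> with values in \<open>F X\<close>, takes equal values at
  \<open>0\<close> and \<open>1\<close>; it is in fact constant.

  Factor \<open>(t a + b) id\<^sub>X\<close> as the row \<open>(t, 1) : X \<oplus> X \<rightarrow> X\<close> after the column
  \<open>(a, b) : X \<rightarrow> X \<oplus> X\<close>. The maps \<open>F (t, 1)\<close> live in a finite-dimensional space of linear maps,
  so the infinitude of \<open>L\<close> forces a nontrivial finite relation \<open>\<Sum> l\<^sub>t F (t, 1) = 0\<close> over
  distinct \<open>t\<close>, whence \<open>\<Sum> l\<^sub>t f (t a + b) = 0\<close> for all \<open>a, b \<in> L\<close>. The coefficients do not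
  depend on \<open>a\<close> and \<open>b\<close>, which makes this a functional equation of Frechet type. Taking differences
  in directions that leave one term unchanged removes the terms one at a time
  (\<open>functional_equation_constant\<close>): by induction all differences of the remaining functions
  are constant, so each of these functions is an additive map up to a constant.
  Additive maps from \<open>L\<close> to a \<open>K\<close>-vector space vanish because the characteristics differ
  (\<open>additive_map_zero_if_char_differs\<close>). Hence \<open>l\<^sub>t f\<close> is constant for every \<open>t\<close>, and some
  \<open>l\<^sub>t\<close> is invertible.
\<close>

section \<open>Linear relations between linear maps\<close>

text \<open>Gaussian elimination, one equation at a time.\<close>

lemma underdetermined_system_nontrivial_solution:
  fixes K :: "('k, 'y) ring_scheme"
  assumes "field K" and "finite I" and "finite T" and "card I < card T"
    and "\<And>t i. \<lbrakk>t \<in> T; i \<in> I\<rbrakk> \<Longrightarrow> x t i \<in> carrier K"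
  shows "\<exists>l \<in> T \<rightarrow> carrier K. (\<exists>t \<in> T. l t \<noteq> \<zero>\<^bsub>K\<^esub>) \<and>
    (\<forall>i \<in> I. (\<Oplus>\<^bsub>K\<^esub>t\<in>T. l t \<otimes>\<^bsub>K\<^esub> x t i) = \<zero>\<^bsub>K\<^esub>)"
  using assms(2-)
proof (induction I arbitrary: T x rule: finite_induct)
  case empty
  interpret K: field K by fact
  from empty show ?case by (intro bexI[of _ "\<lambda>_. \<one>\<^bsub>K\<^esub>"]) (auto simp: card_gt_0_iff)
next
  case (insert i I)
  interpret K: field K by fact
  have x: "x t k \<in> carrier K" if "t \<in> T" "k \<in> insert i I" for t k
    using insert.prems(3) that by blast
  show ?case
  proof (cases "\<forall>t\<in>T. x t i = \<zero>\<^bsub>K\<^esub>")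
    case True
    obtain l where l: "l \<in> T \<rightarrow> carrier K" "\<exists>t \<in> T. l t \<noteq> \<zero>\<^bsub>K\<^esub>"
      and rel: "\<forall>k \<in> I. (\<Oplus>\<^bsub>K\<^esub>t\<in>T. l t \<otimes>\<^bsub>K\<^esub> x t k) = \<zero>\<^bsub>K\<^esub>"
      using insert.IH[of T x] insert.prems insert.hyps by auto
    have "(\<Oplus>\<^bsub>K\<^esub>t\<in>T. l t \<otimes>\<^bsub>K\<^esub> x t i) = (\<Oplus>\<^bsub>K\<^esub>t\<in>T. \<zero>\<^bsub>K\<^esub>)"
      using True l by (intro K.finsum_cong') (auto simp: Pi_iff)
    with l rel show ?thesis by auto
  next
    case False
    then obtain p where p: "p \<in> T" "x p i \<noteq> \<zero>\<^bsub>K\<^esub>" by blast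
    define S where "S = T - {p}"
    have S: "finite S" "p \<notin> S" "T = insert p S" using p insert.prems(1) by (auto simp: S_def)
    define m where "m t = x t i \<otimes>\<^bsub>K\<^esub> inv\<^bsub>K\<^esub> (x p i)" for t
    have unit: "x p i \<in> Units K" using p x K.field_Units by auto
    have m: "m t \<in> carrier K" if "t \<in> T" for t
      using that x p(1) unit by (auto simp: m_def)
    have mi: "m t \<otimes>\<^bsub>K\<^esub> x p i = x t i" if "t \<in> T" for t
      using that x[OF that, of i] x[OF p(1), of i] unit by (simp add: m_def K.m_assoc)
    \<comment> \<open>Equation \<open>i\<close> is solved for the unknown of index \<open>p\<close>; \<open>y\<close> holds the coefficients
      of the other equations after substitution.\<close>
    define y where "y t k = x t k \<ominus>\<^bsub>K\<^esub> m t \<otimes>\<^bsub>K\<^esub> x p k" for t k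
    have y: "y t k \<in> carrier K" if "t \<in> T" "k \<in> insert i I" for t k
      using x m that p by (auto simp: y_def)
    have "card I < card S"
      using insert.prems(1,2) insert.hyps S by simp
    then obtain l where l: "l \<in> S \<rightarrow> carrier K" "\<exists>t \<in> S. l t \<noteq> \<zero>\<^bsub>K\<^esub>"
      and rel: "\<forall>k \<in> I. (\<Oplus>\<^bsub>K\<^esub>t\<in>S. l t \<otimes>\<^bsub>K\<^esub> y t k) = \<zero>\<^bsub>K\<^esub>"
      using insert.IH[of S y] y S by auto
    have lS: "l t \<in> carrier K" if "t \<in> S" for t using l that by auto
    define c where "c = (\<Oplus>\<^bsub>K\<^esub>t\<in>S. l t \<otimes>\<^bsub>K\<^esub> m t)"
    have c: "c \<in> carrier K" using lS m S unfolding c_def by (intro K.finsum_closed) auto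
    define l' where "l' = l(p := \<ominus>\<^bsub>K\<^esub> c)"
    have "(\<Oplus>\<^bsub>K\<^esub>t\<in>T. l' t \<otimes>\<^bsub>K\<^esub> x t k) = \<zero>\<^bsub>K\<^esub>" if k: "k \<in> insert i I" for k
    proof -
      have z: "(\<Oplus>\<^bsub>K\<^esub>t\<in>S. l t \<otimes>\<^bsub>K\<^esub> y t k) = \<zero>\<^bsub>K\<^esub>"
      proof (cases "k = i")
        case True
        have "(\<Oplus>\<^bsub>K\<^esub>t\<in>S. l t \<otimes>\<^bsub>K\<^esub> y t k) = (\<Oplus>\<^bsub>K\<^esub>t\<in>S. \<zero>\<^bsub>K\<^esub>)"
          using True lS S mi x by (intro K.finsum_cong') (auto simp: y_def K.minus_eq K.r_neg)
        then show ?thesis by simp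
      qed (use rel k in auto)
      have xp: "x p k \<in> carrier K" using x p k by auto
      have "(\<Oplus>\<^bsub>K\<^esub>t\<in>S. l t \<otimes>\<^bsub>K\<^esub> x t k)
          = (\<Oplus>\<^bsub>K\<^esub>t\<in>S. l t \<otimes>\<^bsub>K\<^esub> y t k \<oplus>\<^bsub>K\<^esub> (l t \<otimes>\<^bsub>K\<^esub> m t) \<otimes>\<^bsub>K\<^esub> x p k)"
      proof (intro K.finsum_cong')
        fix t assume t: "t \<in> S"
        have "l t \<in> carrier K" "x t k \<in> carrier K" "m t \<in> carrier K"
          using t lS S x m k by auto
        then show "l t \<otimes>\<^bsub>K\<^esub> x t k = l t \<otimes>\<^bsub>K\<^esub> y t k \<oplus>\<^bsub>K\<^esub> (l t \<otimes>\<^bsub>K\<^esub> m t) \<otimes>\<^bsub>K\<^esub> x p k"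
          using xp unfolding y_def by algebra
      qed (use lS S x m y k xp in auto)
      also have "\<dots> = (\<Oplus>\<^bsub>K\<^esub>t\<in>S. l t \<otimes>\<^bsub>K\<^esub> y t k)
          \<oplus>\<^bsub>K\<^esub> (\<Oplus>\<^bsub>K\<^esub>t\<in>S. (l t \<otimes>\<^bsub>K\<^esub> m t) \<otimes>\<^bsub>K\<^esub> x p k)"
        using lS S m y k xp by (intro K.finsum_addf) auto
      also have "(\<Oplus>\<^bsub>K\<^esub>t\<in>S. (l t \<otimes>\<^bsub>K\<^esub> m t) \<otimes>\<^bsub>K\<^esub> x p k) = c \<otimes>\<^bsub>K\<^esub> x p k"
        using lS S m xp unfolding c_def by (intro K.finsum_ldistr[symmetric]) auto
      finally have *: "(\<Oplus>\<^bsub>K\<^esub>t\<in>S. l t \<otimes>\<^bsub>K\<^esub> x t k) = c \<otimes>\<^bsub>K\<^esub> x p k"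
        using z c xp by simp
      have "(\<Oplus>\<^bsub>K\<^esub>t\<in>T. l' t \<otimes>\<^bsub>K\<^esub> x t k)
          = l' p \<otimes>\<^bsub>K\<^esub> x p k \<oplus>\<^bsub>K\<^esub> (\<Oplus>\<^bsub>K\<^esub>t\<in>S. l' t \<otimes>\<^bsub>K\<^esub> x t k)"
        unfolding S(3) using S lS c xp x k
        by (intro K.finsum_insert) (auto simp: l'_def)
      also have "(\<Oplus>\<^bsub>K\<^esub>t\<in>S. l' t \<otimes>\<^bsub>K\<^esub> x t k) = (\<Oplus>\<^bsub>K\<^esub>t\<in>S. l t \<otimes>\<^bsub>K\<^esub> x t k)"
        using S lS x k by (intro K.finsum_cong') (auto simp: l'_def)
      finally show ?thesis using * c xp
        by (simp add: l'_def K.l_minus K.l_neg)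
    qed
    moreover have "l' \<in> T \<rightarrow> carrier K" using lS c S by (auto simp: l'_def)
    moreover have "\<exists>t\<in>T. l' t \<noteq> \<zero>\<^bsub>K\<^esub>" using l S by (auto simp: l'_def)
    ultimately show ?thesis by blast
  qed
qed

lemma (in Module.module) finsum_smult_lincomb:
  assumes "finite T" and "finite C" and "C \<subseteq> carrier M" and "\<And>t. t \<in> T \<Longrightarrow> l t \<in> carrier R"
    and "\<And>t c. \<lbrakk>t \<in> T; c \<in> C\<rbrakk> \<Longrightarrow> x t c \<in> carrier R"
  shows "(\<Oplus>\<^bsub>M\<^esub>t\<in>T. l t \<odot>\<^bsub>M\<^esub> lincomb (x t) C) = lincomb (\<lambda>c. \<Oplus>\<^bsub>R\<^esub>t\<in>T. l t \<otimes>\<^bsub>R\<^esub> x t c) C"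
  using assms(1,4,5)
proof (induction T rule: finite_induct)
  case empty
  have "lincomb (\<lambda>c. \<zero>\<^bsub>R\<^esub>) C = (\<Oplus>\<^bsub>M\<^esub>c\<in>C. \<zero>\<^bsub>M\<^esub>)"
    unfolding lincomb_def using assms(3) by (intro M.finsum_cong') auto
  then show ?case by simp
next
  case (insert r T)
  note C = assms(2,3)
  have closed: "lincomb (x t) C \<in> carrier M" if "t \<in> insert r T" for t
    using that insert.prems C by (intro lincomb_closed) auto
  have "(\<Oplus>\<^bsub>M\<^esub>t\<in>insert r T. l t \<odot>\<^bsub>M\<^esub> lincomb (x t) C)
      = l r \<odot>\<^bsub>M\<^esub> lincomb (x r) C \<oplus>\<^bsub>M\<^esub> (\<Oplus>\<^bsub>M\<^esub>t\<in>T. l t \<odot>\<^bsub>M\<^esub> lincomb (x t) C)"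
    using insert.prems insert.hyps closed by (intro M.finsum_insert) auto
  also have "\<dots> = lincomb (\<lambda>c. l r \<otimes>\<^bsub>R\<^esub> x r c) C \<oplus>\<^bsub>M\<^esub> lincomb (\<lambda>c. \<Oplus>\<^bsub>R\<^esub>t\<in>T. l t \<otimes>\<^bsub>R\<^esub> x t c) C"
    using lincomb_smult[of C "x r" "l r"] C insert by simp
  also have "\<dots> = lincomb (\<lambda>c. l r \<otimes>\<^bsub>R\<^esub> x r c \<oplus>\<^bsub>R\<^esub> (\<Oplus>\<^bsub>R\<^esub>t\<in>T. l t \<otimes>\<^bsub>R\<^esub> x t c)) C"
    using insert.prems by (intro lincomb_sum[OF C, symmetric]) auto
  also have "\<dots> = lincomb (\<lambda>c. \<Oplus>\<^bsub>R\<^esub>t\<in>insert r T. l t \<otimes>\<^bsub>R\<^esub> x t c) C"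
    using insert.prems insert.hyps C by (intro lincomb_cong) auto
  finally show ?case .
qed

lemma linear_map_closed:
  assumes "linear_map K V W T" and "v \<in> carrier V"
  shows "T v \<in> carrier W"
proof -
  interpret linear_map K V W T by fact
  show ?thesis using assms(2) by (rule f_im)
qed

text \<open>Linear maps between two fixed finite-dimensional spaces are determined by finitely many
  scalars, their coordinates in generating sets \<open>B\<close> and \<open>C\<close>, so more than \<open>card B * card C\<close>
  of them are linearly dependent.\<close>

lemma infinite_family_linear_relation:
  fixes K :: "('k, 'y) ring_scheme" and V :: "('k, 'v) module" and W :: "('k, 'w) module"
  assumes "vectorspace K V" and "vectorspace K W"
    and "vectorspace.fin_dim K V" and "vectorspace.fin_dim K W"
    and "infinite T" and u: "\<And>t. t \<in> T \<Longrightarrow> linear_map K V W (u t)"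
  obtains S l where "S \<subseteq> T" and "finite S" and "l \<in> S \<rightarrow> carrier K" and "\<exists>t\<in>S. l t \<noteq> \<zero>\<^bsub>K\<^esub>"
    and "\<And>v. v \<in> carrier V \<Longrightarrow> (\<Oplus>\<^bsub>W\<^esub>t\<in>S. l t \<odot>\<^bsub>W\<^esub> u t v) = \<zero>\<^bsub>W\<^esub>"
proof -
  interpret V: vectorspace K V by fact
  interpret W: vectorspace K W by fact
  have fK: "field K" using assms(2) by (simp add: vectorspace_def)
  obtain B where B: "finite B" "B \<subseteq> carrier V" "V.span B = carrier V"
    using assms(3) unfolding V.fin_dim_def by blast
  obtain C where C: "finite C" "C \<subseteq> carrier W" "W.span C = carrier W"
    using assms(4) unfolding W.fin_dim_def by blast
  have uW: "u t v \<in> carrier W" if "t \<in> T" "v \<in> carrier V" for t v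
    using linear_map_closed[OF u[OF that(1)] that(2)] .
  have "\<forall>t b. \<exists>a. t \<in> T \<longrightarrow> b \<in> B \<longrightarrow> a \<in> C \<rightarrow> carrier K \<and> W.lincomb a C = u t b"
    using W.finite_in_span[OF C(1,2)] uW B(2) C(3) by (metis subset_iff)
  then obtain x where x: "\<And>t b. \<lbrakk>t \<in> T; b \<in> B\<rbrakk> \<Longrightarrow> x t b \<in> C \<rightarrow> carrier K"
    and xu: "\<And>t b. \<lbrakk>t \<in> T; b \<in> B\<rbrakk> \<Longrightarrow> W.lincomb (x t b) C = u t b" by metis
  obtain S where S: "S \<subseteq> T" "finite S" "card S = Suc (card (B \<times> C))"
    using infinite_arbitrarily_large[OF \<open>infinite T\<close>] by metis
  have "\<exists>l \<in> S \<rightarrow> carrier K. (\<exists>t\<in>S. l t \<noteq> \<zero>\<^bsub>K\<^esub>) \<and>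
    (\<forall>k \<in> B \<times> C. (\<Oplus>\<^bsub>K\<^esub>t\<in>S. l t \<otimes>\<^bsub>K\<^esub> x t (fst k) (snd k)) = \<zero>\<^bsub>K\<^esub>)"
  proof (rule underdetermined_system_nontrivial_solution[OF fK])
    fix t k assume "t \<in> S" "k \<in> B \<times> C"
    then show "x t (fst k) (snd k) \<in> carrier K"
      using x[of t "fst k"] S(1) by (auto simp: Pi_iff)
  qed (use S B(1) C(1) in auto)
  then obtain l where lK: "l \<in> S \<rightarrow> carrier K"
    and l': "(\<exists>t\<in>S. l t \<noteq> \<zero>\<^bsub>K\<^esub>) \<and>
      (\<forall>k \<in> B \<times> C. (\<Oplus>\<^bsub>K\<^esub>t\<in>S. l t \<otimes>\<^bsub>K\<^esub> x t (fst k) (snd k)) = \<zero>\<^bsub>K\<^esub>)"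
    by (elim bexE)
  note l = lK conjunct1[OF l']
  from l' have "\<forall>k \<in> B \<times> C. (\<Oplus>\<^bsub>K\<^esub>t\<in>S. l t \<otimes>\<^bsub>K\<^esub> x t (fst k) (snd k)) = \<zero>\<^bsub>K\<^esub>"
    by (rule conjunct2)
  then have rel: "(\<Oplus>\<^bsub>K\<^esub>t\<in>S. l t \<otimes>\<^bsub>K\<^esub> x t b c) = \<zero>\<^bsub>K\<^esub>" if "b \<in> B" "c \<in> C" for b c
    using that by force
  have lS: "l t \<in> carrier K" if "t \<in> S" for t using l that by auto
  have lu: "l t \<odot>\<^bsub>W\<^esub> u t v \<in> carrier W" if "t \<in> S" "v \<in> carrier V" for t v
    using that lS uW S(1) by (meson W.smult_closed subsetD)
  let ?N = "{v \<in> carrier V. (\<Oplus>\<^bsub>W\<^esub>t\<in>S. l t \<odot>\<^bsub>W\<^esub> u t v) = \<zero>\<^bsub>W\<^esub>}"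
  have "B \<subseteq> ?N"
  proof
    fix b assume b: "b \<in> B"
    have xS: "x t b c \<in> carrier K" if "t \<in> S" "c \<in> C" for t c
      using x[of t b] b S that by auto
    have "W.lincomb (x t b) C = u t b" if "t \<in> S" for t
      using xu b S(1) that by blast
    then have "(\<Oplus>\<^bsub>W\<^esub>t\<in>S. l t \<odot>\<^bsub>W\<^esub> u t b) = (\<Oplus>\<^bsub>W\<^esub>t\<in>S. l t \<odot>\<^bsub>W\<^esub> W.lincomb (x t b) C)"
      using lu b B(2) by (intro W.M.finsum_cong') auto
    also have "\<dots> = W.lincomb (\<lambda>c. \<Oplus>\<^bsub>K\<^esub>t\<in>S. l t \<otimes>\<^bsub>K\<^esub> x t b c) C"
      using S(2) C(1,2) lS xS by (rule W.finsum_smult_lincomb)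
    also have "\<dots> = W.lincomb (\<lambda>c. \<zero>\<^bsub>K\<^esub>) C"
      using rel b C by (intro W.lincomb_cong) auto
    also have "\<dots> = (\<Oplus>\<^bsub>W\<^esub>c\<in>C. \<zero>\<^bsub>W\<^esub>)"
      unfolding W.lincomb_def using C by (intro W.M.finsum_cong') auto
    finally show "b \<in> ?N" using b B(2) by auto
  qed
  moreover have "submodule K ?N V"
  proof
    fix v w assume v: "v \<in> ?N" and w: "w \<in> ?N"
    have "(\<Oplus>\<^bsub>W\<^esub>t\<in>S. l t \<odot>\<^bsub>W\<^esub> u t (v \<oplus>\<^bsub>V\<^esub> w))
        = (\<Oplus>\<^bsub>W\<^esub>t\<in>S. l t \<odot>\<^bsub>W\<^esub> u t v \<oplus>\<^bsub>W\<^esub> l t \<odot>\<^bsub>W\<^esub> u t w)"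
    proof (intro W.M.finsum_cong')
      fix t assume t: "t \<in> S"
      then interpret u: linear_map K V W "u t" using u S by auto
      show "l t \<odot>\<^bsub>W\<^esub> u t (v \<oplus>\<^bsub>V\<^esub> w) = l t \<odot>\<^bsub>W\<^esub> u t v \<oplus>\<^bsub>W\<^esub> l t \<odot>\<^bsub>W\<^esub> u t w"
        using v w lS[OF t] by (simp add: W.smult_r_distr)
    qed (use v w lu in auto)
    also have "\<dots> = (\<Oplus>\<^bsub>W\<^esub>t\<in>S. l t \<odot>\<^bsub>W\<^esub> u t v) \<oplus>\<^bsub>W\<^esub> (\<Oplus>\<^bsub>W\<^esub>t\<in>S. l t \<odot>\<^bsub>W\<^esub> u t w)"
      using v w lu by (intro W.M.finsum_addf) auto
    finally show "v \<oplus>\<^bsub>V\<^esub> w \<in> ?N" using v w by simp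
  next
    have "(\<Oplus>\<^bsub>W\<^esub>t\<in>S. l t \<odot>\<^bsub>W\<^esub> u t \<zero>\<^bsub>V\<^esub>) = (\<Oplus>\<^bsub>W\<^esub>t\<in>S. \<zero>\<^bsub>W\<^esub>)"
    proof (intro W.M.finsum_cong')
      fix t assume t: "t \<in> S"
      then interpret u: linear_map K V W "u t" using u S by auto
      show "l t \<odot>\<^bsub>W\<^esub> u t \<zero>\<^bsub>V\<^esub> = \<zero>\<^bsub>W\<^esub>" using lS[OF t] by simp
    qed auto
    then show "\<zero>\<^bsub>V\<^esub> \<in> ?N" by simp
  next
    fix c v assume c: "c \<in> carrier K" and v: "v \<in> ?N"
    have "(\<Oplus>\<^bsub>W\<^esub>t\<in>S. l t \<odot>\<^bsub>W\<^esub> u t (c \<odot>\<^bsub>V\<^esub> v)) = (\<Oplus>\<^bsub>W\<^esub>t\<in>S. c \<odot>\<^bsub>W\<^esub> (l t \<odot>\<^bsub>W\<^esub> u t v))"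
    proof (intro W.M.finsum_cong')
      fix t assume t: "t \<in> S"
      then interpret u: linear_map K V W "u t" using u S by auto
      show "l t \<odot>\<^bsub>W\<^esub> u t (c \<odot>\<^bsub>V\<^esub> v) = c \<odot>\<^bsub>W\<^esub> (l t \<odot>\<^bsub>W\<^esub> u t v)"
        using v c lS[OF t] by (simp add: W.smult_assoc1[symmetric] V.R.m_comm)
    qed (use v c lu in auto)
    also have "\<dots> = c \<odot>\<^bsub>W\<^esub> (\<Oplus>\<^bsub>W\<^esub>t\<in>S. l t \<odot>\<^bsub>W\<^esub> u t v)"
      using v c lu by (intro W.finsum_smult[symmetric]) auto
    finally show "c \<odot>\<^bsub>V\<^esub> v \<in> ?N" using v c by simp
  qed auto
  ultimately have "carrier V \<subseteq> ?N" using V.span_is_subset[of B ?N] B(3) by simp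
  then show ?thesis using that[of S l] S l by auto
qed

section \<open>A functional equation over a field\<close>

text \<open>By induction on \<open>I\<close>. Replacing \<open>(a, b)\<close> by \<open>(a + c, b - t\<^sub>j c)\<close> fixes
  \<open>t\<^sub>j a + b\<close> and shifts \<open>t\<^sub>k a + b\<close> by \<open>(t\<^sub>k - t\<^sub>j) c\<close>, so subtracting the two equations
  yields one of the same shape for the differences of the other functions. These differences are
  then constant in the base point, which means that \<open>g\<^sub>k - g\<^sub>k(0)\<close> is additive and hence zero. The
  function \<open>g\<^sub>j\<close> is constant because all the other terms are.\<close>

lemma functional_equation_constant:
  fixes L :: "('l, 'z) ring_scheme" and V :: "('v, 'w) ring_scheme"
  assumes "field L" and "abelian_group V"
    and no_hom: "\<And>h c. \<lbrakk>h \<in> hom (add_monoid L) (add_monoid V); c \<in> carrier L\<rbrakk> \<Longrightarrow> h c = \<zero>\<^bsub>V\<^esub>"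
    and "finite I" and "inj_on t I" and "t \<in> I \<rightarrow> carrier L"
    and "\<And>i. i \<in> I \<Longrightarrow> g i \<in> carrier L \<rightarrow> carrier V"
    and "\<And>a b. \<lbrakk>a \<in> carrier L; b \<in> carrier L\<rbrakk>
      \<Longrightarrow> (\<Oplus>\<^bsub>V\<^esub>i\<in>I. g i (t i \<otimes>\<^bsub>L\<^esub> a \<oplus>\<^bsub>L\<^esub> b)) = \<zero>\<^bsub>V\<^esub>"
    and "i \<in> I" and "a \<in> carrier L"
  shows "g i a = g i \<zero>\<^bsub>L\<^esub>"
  using assms(4-)
proof (induction I arbitrary: g i a rule: finite_induct)
  case empty
  then show ?case by simp
next
  case (insert j J)
  interpret L: field L by fact
  interpret V: abelian_group V by fact
  note eq = insert.prems(4)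
  have t: "t k \<in> carrier L" if "k \<in> insert j J" for k using insert.prems(2) that by auto
  have g: "g k c \<in> carrier V" if "k \<in> insert j J" "c \<in> carrier L" for k c
    using insert.prems(3) that by blast
  have J: "g k d = g k \<zero>\<^bsub>L\<^esub>" if k: "k \<in> J" and d: "d \<in> carrier L" for k d
  proof -
    have tk: "t k \<in> carrier L" "t j \<in> carrier L" using t k by auto
    \<comment> \<open>Differences along \<open>(c, -t\<^sub>j c)\<close>, a direction in which the term of index \<open>j\<close> is invariant.\<close>
    have diff: "g k (e \<oplus>\<^bsub>L\<^esub> (t k \<ominus>\<^bsub>L\<^esub> t j) \<otimes>\<^bsub>L\<^esub> c) \<ominus>\<^bsub>V\<^esub> g k e
        = g k (\<zero>\<^bsub>L\<^esub> \<oplus>\<^bsub>L\<^esub> (t k \<ominus>\<^bsub>L\<^esub> t j) \<otimes>\<^bsub>L\<^esub> c) \<ominus>\<^bsub>V\<^esub> g k \<zero>\<^bsub>L\<^esub>"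
      if e: "e \<in> carrier L" and c: "c \<in> carrier L" for e c
    proof -
      define D where "D k e = g k (e \<oplus>\<^bsub>L\<^esub> (t k \<ominus>\<^bsub>L\<^esub> t j) \<otimes>\<^bsub>L\<^esub> c) \<ominus>\<^bsub>V\<^esub> g k e" for k e
      have D: "D k e \<in> carrier V" if "k \<in> J" "e \<in> carrier L" for k e
        using that g t c by (auto simp: D_def)
      have "(\<Oplus>\<^bsub>V\<^esub>i\<in>J. D i (t i \<otimes>\<^bsub>L\<^esub> a \<oplus>\<^bsub>L\<^esub> b)) = \<zero>\<^bsub>V\<^esub>"
        if a: "a \<in> carrier L" and b: "b \<in> carrier L" for a b
      proof -
        let ?P = "\<lambda>i. t i \<otimes>\<^bsub>L\<^esub> a \<oplus>\<^bsub>L\<^esub> b"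
        let ?Q = "\<lambda>i. t i \<otimes>\<^bsub>L\<^esub> (a \<oplus>\<^bsub>L\<^esub> c) \<oplus>\<^bsub>L\<^esub> (b \<ominus>\<^bsub>L\<^esub> t j \<otimes>\<^bsub>L\<^esub> c)"
        have Q: "?Q i = ?P i \<oplus>\<^bsub>L\<^esub> (t i \<ominus>\<^bsub>L\<^esub> t j) \<otimes>\<^bsub>L\<^esub> c" if "i \<in> insert j J" for i
          using t[OF that] tk a b c by algebra
        have Qj: "?Q j = ?P j" using tk a b c by algebra
        have closed: "?P i \<in> carrier L" "?Q i \<in> carrier L" if "i \<in> insert j J" for i
          using t[OF that] tk a b c by auto
        have split: "g j (f j) \<oplus>\<^bsub>V\<^esub> (\<Oplus>\<^bsub>V\<^esub>i\<in>J. g i (f i)) = (\<Oplus>\<^bsub>V\<^esub>i\<in>insert j J. g i (f i))"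
          if "\<And>i. i \<in> insert j J \<Longrightarrow> f i \<in> carrier L" for f
          using that insert.hyps g by (intro V.finsum_insert[symmetric]) auto
        have SP: "g j (?P j) \<oplus>\<^bsub>V\<^esub> (\<Oplus>\<^bsub>V\<^esub>i\<in>J. g i (?P i)) = \<zero>\<^bsub>V\<^esub>"
          using split[of ?P] eq[OF a b] closed by simp
        have SQ: "g j (?P j) \<oplus>\<^bsub>V\<^esub> (\<Oplus>\<^bsub>V\<^esub>i\<in>J. g i (?Q i)) = \<zero>\<^bsub>V\<^esub>"
          using split[of ?Q] eq[of "a \<oplus>\<^bsub>L\<^esub> c" "b \<ominus>\<^bsub>L\<^esub> t j \<otimes>\<^bsub>L\<^esub> c"] a b c tk closed(2) Qj
          by simp
        have "(\<Oplus>\<^bsub>V\<^esub>i\<in>J. g i (?Q i)) = (\<Oplus>\<^bsub>V\<^esub>i\<in>J. D i (?P i) \<oplus>\<^bsub>V\<^esub> g i (?P i))"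
        proof (intro V.finsum_cong')
          fix i assume i: "i \<in> J"
          have "g i (?Q i) \<in> carrier V" "g i (?P i) \<in> carrier V" using i g closed by auto
          moreover have "D i (?P i) = g i (?Q i) \<ominus>\<^bsub>V\<^esub> g i (?P i)"
            using Q[of i] i by (simp add: D_def)
          ultimately show "g i (?Q i) = D i (?P i) \<oplus>\<^bsub>V\<^esub> g i (?P i)" 
            by (simp add: V.minus_eq V.a_assoc V.l_neg)
        qed (use D g closed in auto)
        also have "\<dots> = (\<Oplus>\<^bsub>V\<^esub>i\<in>J. D i (?P i)) \<oplus>\<^bsub>V\<^esub> (\<Oplus>\<^bsub>V\<^esub>i\<in>J. g i (?P i))"
          using D g closed by (intro V.finsum_addf) auto
        finally have "(\<Oplus>\<^bsub>V\<^esub>i\<in>J. g i (?Q i)) 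
            = (\<Oplus>\<^bsub>V\<^esub>i\<in>J. D i (?P i)) \<oplus>\<^bsub>V\<^esub> (\<Oplus>\<^bsub>V\<^esub>i\<in>J. g i (?P i))" .
        moreover have "(\<Oplus>\<^bsub>V\<^esub>i\<in>J. g i (?Q i)) = (\<Oplus>\<^bsub>V\<^esub>i\<in>J. g i (?P i))"
        proof -
          have cancel: "y = z" if "u \<oplus>\<^bsub>V\<^esub> y = u \<oplus>\<^bsub>V\<^esub> z"
            "u \<in> carrier V" "y \<in> carrier V" "z \<in> carrier V" for u y z
            using that by (metis V.a_comm V.add.right_cancel)
          show ?thesis
            by (rule cancel[OF trans[OF SQ SP[symmetric]]]) (use g closed in \<open>auto intro!: V.finsum_closed\<close>)
        qed
        moreover have "(\<Oplus>\<^bsub>V\<^esub>i\<in>J. g i (?P i)) \<in> carrier V" 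
          "(\<Oplus>\<^bsub>V\<^esub>i\<in>J. D i (?P i)) \<in> carrier V" using g D closed by (auto intro!: V.finsum_closed)
        ultimately show ?thesis using V.add.r_cancel_one' by simp
      qed
      then have "D k e = D k \<zero>\<^bsub>L\<^esub>"
        using insert.IH[of D k e] insert.prems(1,2) D k e by (auto simp: inj_on_def)
      then show ?thesis by (simp add: D_def)
    qed
    have "t k \<noteq> t j" using insert.prems(1) insert.hyps k by (auto simp: inj_on_def)
    then have nz: "t k \<ominus>\<^bsub>L\<^esub> t j \<noteq> \<zero>\<^bsub>L\<^esub>" using tk by simp
    define h where "h c = g k c \<ominus>\<^bsub>V\<^esub> g k \<zero>\<^bsub>L\<^esub>" for c
    have g': "g k c \<in> carrier V" if "c \<in> carrier L" for c using g k that by auto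
    have shift: "g k (e \<oplus>\<^bsub>L\<^esub> c) \<ominus>\<^bsub>V\<^esub> g k e = h c" if e: "e \<in> carrier L" and c: "c \<in> carrier L" for e c
    proof -
      let ?s = "t k \<ominus>\<^bsub>L\<^esub> t j"
      have s: "?s \<in> Units L" using nz tk L.field_Units by auto
      have "?s \<otimes>\<^bsub>L\<^esub> (inv\<^bsub>L\<^esub> ?s \<otimes>\<^bsub>L\<^esub> c) = c"
        using s c by (metis L.Units_closed L.Units_inv_closed L.Units_r_inv L.l_one L.m_assoc)
      then show ?thesis using diff[OF e, of "inv\<^bsub>L\<^esub> ?s \<otimes>\<^bsub>L\<^esub> c"] s c by (simp add: h_def)
    qed
    have "h (e \<oplus>\<^bsub>L\<^esub> c) = h e \<oplus>\<^bsub>V\<^esub> h c" if e: "e \<in> carrier L" and c: "c \<in> carrier L" for e c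
    proof -
      have "h c \<oplus>\<^bsub>V\<^esub> h e = (g k (e \<oplus>\<^bsub>L\<^esub> c) \<ominus>\<^bsub>V\<^esub> g k e) \<oplus>\<^bsub>V\<^esub> (g k e \<ominus>\<^bsub>V\<^esub> g k \<zero>\<^bsub>L\<^esub>)"
        using shift[OF e c] by (simp add: h_def)
      also have "\<dots> = h (e \<oplus>\<^bsub>L\<^esub> c)"
        using g'[of e] g'[of "e \<oplus>\<^bsub>L\<^esub> c"] g'[of "\<zero>\<^bsub>L\<^esub>"] e c unfolding h_def
        by (simp add: V.minus_eq V.a_assoc V.r_neg2 V.r_neg1)
      finally show ?thesis using g' e c by (simp add: h_def V.a_comm)
    qed
    then have "h \<in> hom (add_monoid L) (add_monoid V)"
      using g' by (auto simp: hom_def h_def)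
    then have "h d = \<zero>\<^bsub>V\<^esub>" using no_hom d by blast
    then show ?thesis using g' d by (simp add: h_def)
  qed
  show ?case
  proof (cases "i = j")
    case False
    then show ?thesis using J[of i a] insert.prems(5,6) by blast
  next
    case True
    let ?c = "\<Oplus>\<^bsub>V\<^esub>k\<in>J. g k \<zero>\<^bsub>L\<^esub>"
    have gz: "?c \<in> carrier V" using g by (intro V.finsum_closed) auto
    have "g j b \<oplus>\<^bsub>V\<^esub> ?c = \<zero>\<^bsub>V\<^esub>" if b: "b \<in> carrier L" for b
    proof -
      have "(\<Oplus>\<^bsub>V\<^esub>k\<in>J. g k b) = ?c"
        using g by (intro V.finsum_cong') (auto intro: J[OF _ b])
      moreover have "(\<Oplus>\<^bsub>V\<^esub>k\<in>insert j J. g k (t k \<otimes>\<^bsub>L\<^esub> \<zero>\<^bsub>L\<^esub> \<oplus>\<^bsub>L\<^esub> b)) = (\<Oplus>\<^bsub>V\<^esub>k\<in>insert j J. g k b)"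
        using g t b by (intro V.finsum_cong') auto
      moreover have "(\<Oplus>\<^bsub>V\<^esub>k\<in>insert j J. g k b) = g j b \<oplus>\<^bsub>V\<^esub> (\<Oplus>\<^bsub>V\<^esub>k\<in>J. g k b)"
        using g b insert.hyps by (intro V.finsum_insert) auto
      ultimately show ?thesis using eq[of "\<zero>\<^bsub>L\<^esub>" b] b by simp
    qed
    then have "g j a \<oplus>\<^bsub>V\<^esub> ?c = g j \<zero>\<^bsub>L\<^esub> \<oplus>\<^bsub>V\<^esub> ?c" using insert.prems(6) by simp
    then show ?thesis using gz g True insert.prems(6) by simp
  qed
qed

section \<open>Additive maps in different characteristics\<close>

lemma ring_char_dvd_iff:
  assumes "ring R"
  shows "[(n::nat)] \<cdot>\<^bsub>R\<^esub> \<one>\<^bsub>R\<^esub> = \<zero>\<^bsub>R\<^esub> \<longleftrightarrow> ring_char R dvd n"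
proof -
  interpret ring R by fact
  show ?thesis
    using add.pow_eq_id[of "\<one>\<^bsub>R\<^esub>" n] by (simp add: ring_char_def add_pow_def)
qed

text \<open>Divisibility of natural numbers is antisymmetric, so one of the characteristics \<open>p\<close> of \<open>K\<close> and
  \<open>q\<close> of \<open>L\<close> does not divide the other. If \<open>p\<close> does not divide \<open>q\<close>, then \<open>q\<close> is zero in \<open>L\<close>
  but invertible in \<open>K\<close>, and \<open>q h(c) = h(q c) = 0\<close>. Otherwise \<open>p\<close> is invertible in \<open>L\<close>
  and zero in \<open>K\<close>, and \<open>h(c) = p h(c / p) = 0\<close>. Characteristic zero fits in because every number
  divides \<open>0\<close>.\<close>

lemma additive_map_zero_if_char_differs:
  fixes L :: "('l, 'z) ring_scheme" and K :: "('k, 'y) ring_scheme" and V :: "('k, 'v) module"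
  assumes "field L" and "vectorspace K V" and char: "ring_char L \<noteq> ring_char K"
    and h: "h \<in> hom (add_monoid L) (add_monoid V)" and c: "c \<in> carrier L"
  shows "h c = \<zero>\<^bsub>V\<^esub>"
proof -
  interpret L: field L by fact
  interpret V: vectorspace K V by fact
  interpret h: group_hom "add_monoid L" "add_monoid V" h
    using h L.add.group_axioms V.M.add.group_axioms by (simp add: group_hom_def group_hom_axioms_def)
  have hV: "h a \<in> carrier V" if "a \<in> carrier L" for a using h.hom_closed that by simp
  have hn: "h ([n] \<cdot>\<^bsub>L\<^esub> a) = [n] \<cdot>\<^bsub>V\<^esub> h a" if "a \<in> carrier L" for a and n :: nat
    using h.hom_nat_pow[of a n] that by (simp add: add_pow_def)
  have nV: "[n] \<cdot>\<^bsub>V\<^esub> v = ([n] \<cdot>\<^bsub>K\<^esub> \<one>\<^bsub>K\<^esub>) \<odot>\<^bsub>V\<^esub> v" if v: "v \<in> carrier V" for v and n :: nat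
  proof (induction n)
    case (Suc n)
    then show ?case using v by (simp add: V.smult_l_distr)
  qed (use v in simp)
  have nL: "[n] \<cdot>\<^bsub>L\<^esub> a = ([n] \<cdot>\<^bsub>L\<^esub> \<one>\<^bsub>L\<^esub>) \<otimes>\<^bsub>L\<^esub> a" if "a \<in> carrier L" for a and n :: nat
    using L.add_pow_ldistr[of "\<one>\<^bsub>L\<^esub>" a n] that by simp
  have hom: "h (([n] \<cdot>\<^bsub>L\<^esub> \<one>\<^bsub>L\<^esub>) \<otimes>\<^bsub>L\<^esub> a) = ([n] \<cdot>\<^bsub>K\<^esub> \<one>\<^bsub>K\<^esub>) \<odot>\<^bsub>V\<^esub> h a" if "a \<in> carrier L" for a and n :: nat
    using hn nV hV nL that by metis
  from char consider "\<not> ring_char K dvd ring_char L" | "\<not> ring_char L dvd ring_char K"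
    using dvd_antisym by blast
  then show ?thesis
  proof cases
    case 1
    define e where "e = [ring_char L] \<cdot>\<^bsub>K\<^esub> \<one>\<^bsub>K\<^esub>"
    have "[ring_char L] \<cdot>\<^bsub>L\<^esub> \<one>\<^bsub>L\<^esub> = \<zero>\<^bsub>L\<^esub>" using ring_char_dvd_iff[OF L.ring_axioms] by simp
    then have z: "e \<odot>\<^bsub>V\<^esub> h c = \<zero>\<^bsub>V\<^esub>" using hom[OF c, of "ring_char L"] c h.hom_one by (simp add: e_def)
    have "e \<noteq> \<zero>\<^bsub>K\<^esub>" using ring_char_dvd_iff[OF V.R.ring_axioms] 1 by (simp add: e_def)
    then have e: "e \<in> Units K" using V.field_Units by (simp add: e_def)
    then have "h c = (inv\<^bsub>K\<^esub> e \<otimes>\<^bsub>K\<^esub> e) \<odot>\<^bsub>V\<^esub> h c" using hV c by simp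
    also have "\<dots> = inv\<^bsub>K\<^esub> e \<odot>\<^bsub>V\<^esub> (e \<odot>\<^bsub>V\<^esub> h c)" using e hV c by (intro V.smult_assoc1) auto
    also have "\<dots> = \<zero>\<^bsub>V\<^esub>" using z e by simp
    finally show ?thesis .
  next
    case 2
    define e where "e = [ring_char K] \<cdot>\<^bsub>L\<^esub> \<one>\<^bsub>L\<^esub>"
    have "e \<noteq> \<zero>\<^bsub>L\<^esub>" using ring_char_dvd_iff[OF L.ring_axioms] 2 by (simp add: e_def)
    then have e: "e \<in> Units L" using L.field_Units by (simp add: e_def)
    have "e \<otimes>\<^bsub>L\<^esub> (inv\<^bsub>L\<^esub> e \<otimes>\<^bsub>L\<^esub> c) = c"
      using e c by (metis L.Units_closed L.Units_inv_closed L.Units_r_inv L.l_one L.m_assoc)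
    then have "h c = ([ring_char K] \<cdot>\<^bsub>K\<^esub> \<one>\<^bsub>K\<^esub>) \<odot>\<^bsub>V\<^esub> h (inv\<^bsub>L\<^esub> e \<otimes>\<^bsub>L\<^esub> c)"
      using hom[of "inv\<^bsub>L\<^esub> e \<otimes>\<^bsub>L\<^esub> c" "ring_char K"] e c by (simp add: e_def)
    also have "[ring_char K] \<cdot>\<^bsub>K\<^esub> \<one>\<^bsub>K\<^esub> = \<zero>\<^bsub>K\<^esub>" using ring_char_dvd_iff[OF V.R.ring_axioms] by simp
    finally show ?thesis using hV e c by simp
  qed
qed

section \<open>Functors on linear categories\<close>

context linear_category
begin

lemma
  assumes "X \<in> Obj A" and "Y \<in> Obj A" and f: "f \<in> Hom A X Y"
  shows scale_closed: "a \<in> carrier L \<Longrightarrow> s a f \<in> Hom A X Y"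
    and Add_closed: "g \<in> Hom A X Y \<Longrightarrow> Add A f g \<in> Hom A X Y"
    and scale_add: "\<lbrakk>a \<in> carrier L; b \<in> carrier L\<rbrakk> \<Longrightarrow> s (a \<oplus>\<^bsub>L\<^esub> b) f = Add A (s a f) (s b f)"
    and scale_mult: "\<lbrakk>a \<in> carrier L; b \<in> carrier L\<rbrakk> \<Longrightarrow> s (a \<otimes>\<^bsub>L\<^esub> b) f = s a (s b f)"
    and scale_one: "s \<one>\<^bsub>L\<^esub> f = f"
    and scale_zero: "s \<zero>\<^bsub>L\<^esub> f = Zero A X Y"
    and Add_Zero_right: "Add A f (Zero A X Y) = f"
    and Add_Zero_left: "Add A (Zero A X Y) f = f"
    and Zero_closed: "Zero A X Y \<in> Hom A X Y"
proof -
  interpret H: vectorspace L "hom_space A s X Y" using assms by (intro hom_vectorspace)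
  have f': "f \<in> carrier (hom_space A s X Y)" using f by (simp add: hom_space_def)
  show "a \<in> carrier L \<Longrightarrow> s a f \<in> Hom A X Y"
    using H.smult_closed[OF _ f'] by (simp add: hom_space_def)
  show "g \<in> Hom A X Y \<Longrightarrow> Add A f g \<in> Hom A X Y"
    using H.M.add.m_closed[OF f'] by (simp add: hom_space_def)
  show "\<lbrakk>a \<in> carrier L; b \<in> carrier L\<rbrakk> \<Longrightarrow> s (a \<oplus>\<^bsub>L\<^esub> b) f = Add A (s a f) (s b f)"
    using H.smult_l_distr[OF _ _ f'] by (simp add: hom_space_def)
  show "\<lbrakk>a \<in> carrier L; b \<in> carrier L\<rbrakk> \<Longrightarrow> s (a \<otimes>\<^bsub>L\<^esub> b) f = s a (s b f)"
    using H.smult_assoc1[OF _ _ f'] by (simp add: hom_space_def)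
  show "s \<one>\<^bsub>L\<^esub> f = f" using H.smult_one[OF f'] by (simp add: hom_space_def)
  show "s \<zero>\<^bsub>L\<^esub> f = Zero A X Y" using H.lmult_0[OF f'] by (simp add: hom_space_def)
  show "Add A f (Zero A X Y) = f" using H.M.r_zero[OF f'] by (simp add: hom_space_def)
  show "Add A (Zero A X Y) f = f" using H.M.l_zero[OF f'] by (simp add: hom_space_def)
  show "Zero A X Y \<in> Hom A X Y" using H.M.zero_closed by (simp add: hom_space_def)
qed

lemma scale_Zero:
  assumes "X \<in> Obj A" and "Y \<in> Obj A" and "a \<in> carrier L" and "f \<in> Hom A X Y"
  shows "s a (Zero A X Y) = Zero A X Y"
  using assms scale_mult[of X Y f a "\<zero>\<^bsub>L\<^esub>"] scale_zero[of X Y f] by simp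

text \<open>The matrix product \<open>(t, 1) (a, b)\<^sup>T = t a + b\<close>, read through a biproduct \<open>X \<oplus> X\<close>.\<close>

lemma row_column_composite:
  assumes bi: "biproduct A X X P i j p q" and X: "X \<in> Obj A"
    and t: "t \<in> carrier L" and a: "a \<in> carrier L" and b: "b \<in> carrier L"
  shows "Comp A (Add A (s t p) q) (Add A (s a i) (s b j)) = s (t \<otimes>\<^bsub>L\<^esub> a \<oplus>\<^bsub>L\<^esub> b) (Ident A X)"
proof -
  from bi have P: "P \<in> Obj A" and mor: "i \<in> Hom A X P" "j \<in> Hom A X P" "p \<in> Hom A P X" "q \<in> Hom A P X"
    and eqs: "Comp A p i = Ident A X" "Comp A q j = Ident A X"
      "Comp A p j = Zero A X X" "Comp A q i = Zero A X X"
    by (auto simp: biproduct_def)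
  let ?I = "Ident A X" and ?c = "Add A (s a i) (s b j)"
  have I: "?I \<in> Hom A X X" using X by (rule Ident_closed)
  have cl: "s a i \<in> Hom A X P" "s b j \<in> Hom A X P" "s t p \<in> Hom A P X"
    using mor P X t a b by (auto intro: scale_closed)
  have pc: "Comp A p ?c = s a ?I"
  proof -
    have "Comp A p ?c = Add A (s a ?I) (s b (Zero A X X))"
      using Comp_Add_right[OF X P X mor(3) cl(1,2)] Comp_scale_right[OF a X P X mor(3,1)]
        Comp_scale_right[OF b X P X mor(3,2)] eqs by simp
    then show ?thesis
      using scale_Zero[OF X X b I] Add_Zero_right[OF X X scale_closed[OF X X I a]] by simp
  qed
  have qc: "Comp A q ?c = s b ?I"
  proof -
    have "Comp A q ?c = Add A (s a (Zero A X X)) (s b ?I)"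
      using Comp_Add_right[OF X P X mor(4) cl(1,2)] Comp_scale_right[OF a X P X mor(4,1)]
        Comp_scale_right[OF b X P X mor(4,2)] eqs by simp
    then show ?thesis
      using scale_Zero[OF X X a I] Add_Zero_left[OF X X scale_closed[OF X X I b]] by simp
  qed
  have c: "?c \<in> Hom A X P" using Add_closed[OF X P cl(1) cl(2)] .
  have "Comp A (Add A (s t p) q) ?c = Add A (s t (s a ?I)) (s b ?I)"
    using Comp_Add_left[OF X P X cl(3) mor(4) c] Comp_scale_left[OF t X P X mor(3) c] pc qc by simp
  also have "\<dots> = s (t \<otimes>\<^bsub>L\<^esub> a \<oplus>\<^bsub>L\<^esub> b) ?I"
    using scale_mult[OF X X I t a] scale_add[OF X X I _ b, of "t \<otimes>\<^bsub>L\<^esub> a"] t a by simp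
  finally show ?thesis .
qed

end

text \<open>This is where finite dimension, the infinitude of \<open>L\<close> and the characteristics meet.
  The relation is taken between the operators \<open>F (t, 1)\<close> on all of \<open>F P\<close>, so that its
  coefficients are the same for every column \<open>(a, b)\<close>.\<close>

lemma zero_endomorphism_acts_trivially:
  fixes A :: "('o, 'm, 'x) preadd_cat_scheme"
    and F :: "('o, 'm, 'k, 'v) vfunctor"
  assumes "linear_category A L s" and inf: "infinite (carrier L)"
    and char: "ring_char L \<noteq> ring_char K" and F: "F \<in> Fdf A K"
    and bi: "biproduct A X X P i j p q" and X: "X \<in> Obj A" and v: "v \<in> carrier (fobj F X)"
  shows "fmap F (Zero A X X) v = v"
proof -
  interpret linear_category A L s by fact
  interpret F: vect_functor A K F using F by (simp add: Fdf_def)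
  have fL: "field L" ..
  let ?V = "fobj F P" and ?W = "fobj F X" and ?I = "Ident A X"
  from bi have P: "P \<in> Obj A" and mor: "i \<in> Hom A X P" "j \<in> Hom A X P" "p \<in> Hom A P X" "q \<in> Hom A P X"
    by (auto simp: biproduct_def)
  have I: "?I \<in> Hom A X X" using X by (rule Ident_closed)
  interpret W: vectorspace K ?W using X by (rule F.fobj_vectorspace)
  define row where "row t = Add A (s t p) q" for t
  define col where "col a b = Add A (s a i) (s b j)" for a b
  have row: "row t \<in> Hom A P X" if "t \<in> carrier L" for t
    unfolding row_def using that P X mor by (intro Add_closed scale_closed)
  have col: "col a b \<in> Hom A X P" if "a \<in> carrier L" "b \<in> carrier L" for a b
    unfolding col_def using that P X mor by (intro Add_closed scale_closed)
  define f where "f a = fmap F (s a ?I) v" for a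
  have f: "f a \<in> carrier ?W" if "a \<in> carrier L" for a
    unfolding f_def using linear_map_closed[OF F.fmap_linear[OF X X scale_closed[OF X X I that]] v] .
  obtain S l where S: "S \<subseteq> carrier L" "finite S" and l: "l \<in> S \<rightarrow> carrier K"
    and nz: "\<exists>t\<in>S. l t \<noteq> \<zero>\<^bsub>K\<^esub>"
    and rel: "\<And>x. x \<in> carrier ?V \<Longrightarrow> (\<Oplus>\<^bsub>?W\<^esub>t\<in>S. l t \<odot>\<^bsub>?W\<^esub> fmap F (row t) x) = \<zero>\<^bsub>?W\<^esub>"
  proof (rule infinite_family_linear_relation[where u = "\<lambda>t. fmap F (row t)",
        OF F.fobj_vectorspace[OF P] F.fobj_vectorspace[OF X] _ _ inf])
    show "vectorspace.fin_dim K ?V" "vectorspace.fin_dim K ?W"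
      using F P X by (auto simp: Fdf_def)
    show "linear_map K ?V ?W (fmap F (row t))" if "t \<in> carrier L" for t
      using F.fmap_linear[OF P X row[OF that]] .
  qed (rule that)
  have lK: "l t \<in> carrier K" if "t \<in> S" for t using l that by auto
  have eq: "(\<Oplus>\<^bsub>?W\<^esub>t\<in>S. l t \<odot>\<^bsub>?W\<^esub> f (t \<otimes>\<^bsub>L\<^esub> a \<oplus>\<^bsub>L\<^esub> b)) = \<zero>\<^bsub>?W\<^esub>"
    if a: "a \<in> carrier L" and b: "b \<in> carrier L" for a b
  proof -
    have cv: "fmap F (col a b) v \<in> carrier ?V"
      using linear_map_closed[OF F.fmap_linear[OF X P col[OF a b]] v] .
    have "f (t \<otimes>\<^bsub>L\<^esub> a \<oplus>\<^bsub>L\<^esub> b) = fmap F (row t) (fmap F (col a b) v)" if t: "t \<in> S" for t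
    proof -
      have tL: "t \<in> carrier L" using t S(1) by auto
      show ?thesis
        using F.fmap_Comp[OF X P X row[OF tL] col[OF a b] v]
          row_column_composite[OF bi X tL a b] by (simp add: f_def row_def col_def)
    qed
    moreover have rv: "fmap F (row t) (fmap F (col a b) v) \<in> carrier ?W" if "t \<in> S" for t
      using linear_map_closed[OF F.fmap_linear[OF P X row] cv] S(1) that by blast
    ultimately have "(\<Oplus>\<^bsub>?W\<^esub>t\<in>S. l t \<odot>\<^bsub>?W\<^esub> f (t \<otimes>\<^bsub>L\<^esub> a \<oplus>\<^bsub>L\<^esub> b))
        = (\<Oplus>\<^bsub>?W\<^esub>t\<in>S. l t \<odot>\<^bsub>?W\<^esub> fmap F (row t) (fmap F (col a b) v))"
      using lK rv by (intro W.M.finsum_cong') auto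
    then show ?thesis using rel[OF cv] by simp
  qed
  obtain t where t: "t \<in> S" "l t \<noteq> \<zero>\<^bsub>K\<^esub>" using nz by blast
  have const: "l t \<odot>\<^bsub>?W\<^esub> f \<one>\<^bsub>L\<^esub> = l t \<odot>\<^bsub>?W\<^esub> f \<zero>\<^bsub>L\<^esub>"
  proof (rule functional_equation_constant[where g = "\<lambda>t a. l t \<odot>\<^bsub>?W\<^esub> f a" and I = S and t = "\<lambda>t. t"
        and i = t, OF fL W.M.abelian_group_axioms])
    show "h c = \<zero>\<^bsub>?W\<^esub>" if "h \<in> hom (add_monoid L) (add_monoid ?W)" "c \<in> carrier L" for h c
      using additive_map_zero_if_char_differs[OF fL W.vectorspace_axioms char that] .
  qed (use S t lK f eq in auto)
  have u: "l t \<in> Units K" using t lK F.field_Units by auto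
  have cancel: "w = inv\<^bsub>K\<^esub> l t \<odot>\<^bsub>?W\<^esub> (l t \<odot>\<^bsub>?W\<^esub> w)" if "w \<in> carrier ?W" for w
    using u that W.smult_assoc1[of "inv\<^bsub>K\<^esub> l t" "l t" w] F.Units_inv_closed[OF u] lK[OF t(1)]
      F.Units_l_inv[OF u] by simp
  have "f \<one>\<^bsub>L\<^esub> = f \<zero>\<^bsub>L\<^esub>"
    using cancel[OF f[of "\<one>\<^bsub>L\<^esub>"]] cancel[OF f[of "\<zero>\<^bsub>L\<^esub>"]] const by simp
  then show ?thesis
    using F.fmap_Ident[OF X v] scale_one[OF X X I] scale_zero[OF X X I] by (simp add: f_def)
qed

lemma constant_if_zero_endomorphisms_act_trivially:
  fixes A :: "('o, 'm, 'x) preadd_cat_scheme"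
    and F :: "('o, 'm, 'k, 'v) vfunctor"
  assumes "vect_functor A K F" and "zero_object A Z"
    and triv: "\<And>X f g v. \<lbrakk>X \<in> Obj A; f \<in> Hom A X Z; g \<in> Hom A Z X; v \<in> carrier (fobj F X)\<rbrakk>
      \<Longrightarrow> fmap F (Comp A g f) v = v"
  shows "is_constant A K F"
proof -
  interpret F: vect_functor A K F by fact
  have Z: "Z \<in> Obj A" using assms(2) by (simp add: zero_object_def)
  have "\<forall>X\<in>Obj A. \<exists>f. f \<in> Hom A X Z" "\<forall>X\<in>Obj A. \<exists>g. g \<in> Hom A Z X"
    using assms(2) unfolding zero_object_def by blast+
  then obtain into out where into: "\<And>X. X \<in> Obj A \<Longrightarrow> into X \<in> Hom A X Z"
    and out: "\<And>X. X \<in> Obj A \<Longrightarrow> out X \<in> Hom A Z X" by metis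
  have uto: "f = into X" if "X \<in> Obj A" "f \<in> Hom A X Z" for X f
    using assms(2) into that unfolding zero_object_def by blast
  have ufrom: "f = out X" if "X \<in> Obj A" "f \<in> Hom A Z X" for X f
    using assms(2) out that unfolding zero_object_def by blast
  have idZ: "fmap F f v = v" if "f \<in> Hom A Z Z" "v \<in> carrier (fobj F Z)" for f v
    using uto[OF Z that(1)] uto[OF Z F.Ident_closed[OF Z]] F.fmap_Ident[OF Z that(2)] by simp
  let ?C = "const_functor (fobj F Z) :: ('o, 'm, 'k, 'v) vfunctor"
  let ?\<eta> = "\<lambda>X. fmap F (into X)" and ?\<theta> = "\<lambda>X. fmap F (out X)"
  have "nat_transf A K F ?C ?\<eta>"
    unfolding nat_transf_def const_functor_def vfunctor.simps
  proof (intro conjI ballI)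
    fix X Y f v assume *: "X \<in> Obj A" "Y \<in> Obj A" "f \<in> Hom A X Y" "v \<in> carrier (fobj F X)"
    have "Comp A (into Y) f = into X" using * into F.Comp_closed Z by (intro uto) blast+
    then show "fmap F (into Y) (fmap F f v) = fmap F (into X) v"
      using F.fmap_Comp[OF *(1,2) Z into[OF *(2)] *(3,4)] by simp
  qed (use F.fmap_linear Z into in auto)
  moreover have "nat_transf A K ?C F ?\<theta>"
    unfolding nat_transf_def const_functor_def vfunctor.simps
  proof (intro conjI ballI)
    fix X Y f v assume *: "X \<in> Obj A" "Y \<in> Obj A" "f \<in> Hom A X Y" "v \<in> carrier (fobj F Z)"
    have "Comp A f (out X) = out Y" using * out F.Comp_closed Z by (intro ufrom) blast+
    then show "fmap F (out Y) v = fmap F f (fmap F (out X) v)"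
      using F.fmap_Comp[OF Z *(1,2,3) out[OF *(1)] *(4)] by simp
  qed (use F.fmap_linear Z out in auto)
  moreover have "fmap F (out X) (fmap F (into X) v) = v"
    if "X \<in> Obj A" "v \<in> carrier (fobj F X)" for X v
    using F.fmap_Comp[OF that(1) Z that(1) out[OF that(1)] into[OF that(1)] that(2)]
      triv[OF that(1) into[OF that(1)] out[OF that(1)] that(2)] by simp
  moreover have "fmap F (into X) (fmap F (out X) w) = w"
    if "X \<in> Obj A" "w \<in> carrier (fobj F Z)" for X w
    using F.fmap_Comp[OF Z that(1) Z into[OF that(1)] out[OF that(1)] that(2)]
      idZ[OF F.Comp_closed[OF Z that(1) Z into[OF that(1)] out[OF that(1)]] that(2)] by simp
  ultimately have "functor_iso A K F ?C"
    unfolding functor_iso_def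
    by (intro exI[of _ ?\<eta>] exI[of _ ?\<theta>]) (simp add: const_functor_def)
  then show ?thesis
    unfolding is_constant_def using F.fobj_vectorspace[OF Z] by blast
qed

text \<open>Scaling by \<open>0\<close> fixes the only morphism \<open>X \<rightarrow> Z\<close>, so composites through \<open>Z\<close> are
  fixed by it too and are zero morphisms.\<close>

theorem mainTheorem12:
  fixes A :: "('o, 'm, 'x) preadd_cat_scheme"
    and K :: "('k, 'y) ring_scheme"
    and L :: "('l, 'z) ring_scheme"
    and s :: "'l \<Rightarrow> 'm \<Rightarrow> 'm"
  assumes "additive_category A"
    and "field K"
    and "field L"
    and "infinite (carrier L)"
    and "linear_category A L s"
    and "ring_char L \<noteq> ring_char K"
  shows "\<forall>F \<in> (Fdf A K :: ('o, 'm, 'k, 'v) vfunctor set). is_constant A K F"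
proof
  fix F :: "('o, 'm, 'k, 'v) vfunctor" assume F: "F \<in> Fdf A K"
  interpret additive_category A by fact
  interpret linear_category A L s by fact
  obtain Z where Z: "zero_object A Z" using zero_object_exists by blast
  show "is_constant A K F"
  proof (rule constant_if_zero_endomorphisms_act_trivially[OF _ Z])
    fix X f g v
    assume X: "X \<in> Obj A" and f: "f \<in> Hom A X Z" and g: "g \<in> Hom A Z X"
      and v: "v \<in> carrier (fobj F X)"
    have Z': "Z \<in> Obj A" using Z by (simp add: zero_object_def)
    have "f = s \<zero>\<^bsub>L\<^esub> f"
      using Z X f scale_closed[OF X Z' f] unfolding zero_object_def by blast
    then have "Comp A g f = s \<zero>\<^bsub>L\<^esub> (Comp A g f)"
      using Comp_scale_right[OF _ X Z' X g f, of "\<zero>\<^bsub>L\<^esub>"] by simp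
    also have "\<dots> = Zero A X X" using scale_zero[OF X X Comp_closed[OF X Z' X g f]] .
    finally have "Comp A g f = Zero A X X" .
    moreover obtain P i j p q where "biproduct A X X P i j p q" using biproduct_exists[OF X X] by blast
    ultimately show "fmap F (Comp A g f) v = v"
      using zero_endomorphism_acts_trivially[OF assms(5,4,6) F _ X v] by simp
  qed (use F in \<open>simp add: Fdf_def\<close>)
qed

end
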